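(* Let $k_0,k_1$ be continuous real-valued functions on $[0,1]\times[0,1]$, let $\varphi:[0,1]\to[0,1]$ be continuous, and suppose there exist numbers $M>0$ and $L_0,L_1,L_2,L_3\ge 0$ such that: (i) the function $f(x,u,y,v,z)$ is continuous in the domain $\mathcal{D}_M$ and $|f(x,u,y,v,z)|\le M$ for all $(x,u,y,v,z)\in\mathcal{D}_M$; (ii) $|f(x,u_2,y_2,v_2,z_2)-f(x,u_1,y_1,v_1,z_1)|\le L_0|u_2-u_1|+L_1|y_2-y_1|+L_2|v_2-v_1|+L_3|z_2-z_1|$ for all $(x,u_i,y_i,v_i,z_i)\in\mathcal{D}_M$, $i=1,2$; (iii) $q:=(L_0+L_1+L_2K_0+L_3K_1)M_0<1$. Then the boundary value problem $$u^{(4)}(x)=f\Big(x,u(x),u(\varphi(x)),\int_0^1k_0(x,t)u(t)\,dt,\int_0^1k_1(x,t)u(\varphi(t))\,dt\Big),\qquad u(0)=u(1)=u''(0)=u''(1)=0,$$ has a unique solution $u\in C^4[0,1]$ satisfying $|u(x)|\le M_0M$ for all $0\le x\le 1$.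
   Context: $f=f(x,u,y,v,z)$ is a real-valued continuous function of $x\in[0,1]$ and $u,y,v,z\in\mathbb{R}$. $G(x,s)$ is the Green function of $u^{(4)}=0$ with the boundary conditions $u(0)=u''(0)=u(1)=u''(1)=0$: $$G(x,s)=\frac16\begin{cases}s(x-1)(x^2-2x+s^2),&0\le s\le x\le1,\\ x(s-1)(s^2-2s+x^2),&0\le x\le s\le1,\end{cases}$$ so that $u(x)=\int_0^1G(x,s)\psi(s)\,ds$ solves $u^{(4)}=\psi$ with these boundary conditions. Constants: $$M_0=\max_{0\le x\le1}\int_0^1|G(x,s)|\,ds=\tfrac{5}{384},\quad K_0=\max_{0\le x\le1}\int_0^1|k_0(x,s)|\,ds,\quad K_1=\max_{0\le x\le1}\int_0^1|k_1(x,s)|\,ds.$$ Domain: $$\mathcal{D}_M=\{(x,u,y,v,z): 0\le x\le1,\ |u|\le M_0M,\ |y|\le M_0M,\ |v|\le M_0K_0M,\ |z|\le M_0K_1M\}.$$ *)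

theory Defs
  imports "HOL-Analysis.Analysis"
begin

definition green :: "real \<Rightarrow> real \<Rightarrow> real" where
  "green x s =
     (if s \<le> x then s * (x - 1) * (x\<^sup>2 - 2 * x + s\<^sup>2)
      else x * (s - 1) * (s\<^sup>2 - 2 * s + x\<^sup>2)) / 6"

text \<open>For a kernel continuous on the unit square the supremum is attained
  (lemma \<open>kernel_norm_attained\<close>), so it is the maximum over \<open>0 \<le> x \<le> 1\<close>.\<close>

definition kernel_norm :: "(real \<Rightarrow> real \<Rightarrow> real) \<Rightarrow> real" where
  "kernel_norm k = (SUP x\<in>{0..1}. integral {0..1} (\<lambda>s. \<bar>k x s\<bar>))"

definition M0 :: real where
  "M0 = kernel_norm green"

definition domain_D ::
  "(real \<Rightarrow> real \<Rightarrow> real) \<Rightarrow> (real \<Rightarrow> real \<Rightarrow> real) \<Rightarrow> real \<Rightarrow> (real \<times> real \<times> real \<times> real \<times> real) set"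
where
  "domain_D k0 k1 M =
     {(x, u, y, v, z). 0 \<le> x \<and> x \<le> 1 \<and> \<bar>u\<bar> \<le> M0 * M \<and> \<bar>y\<bar> \<le> M0 * M \<and>
        \<bar>v\<bar> \<le> M0 * kernel_norm k0 * M \<and> \<bar>z\<bar> \<le> M0 * kernel_norm k1 * M}"

text \<open>Derivatives are taken within \<open>S\<close>, hence one-sided at the endpoints of an interval;
  the values on \<open>S\<close> depend only on the restriction of \<open>u\<close> to \<open>S\<close>.\<close>

definition nth_deriv_on :: "real set \<Rightarrow> nat \<Rightarrow> (real \<Rightarrow> real) \<Rightarrow> real \<Rightarrow> real" where
  "nth_deriv_on S n u = ((\<lambda>g x. vector_derivative g (at x within S)) ^^ n) u"

definition C_n_on :: "nat \<Rightarrow> real set \<Rightarrow> (real \<Rightarrow> real) \<Rightarrow> bool" where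
  "C_n_on n S u \<longleftrightarrow>
     (\<forall>j<n. nth_deriv_on S j u differentiable_on S) \<and> continuous_on S (nth_deriv_on S n u)"

definition bvp_solution ::
  "(real \<Rightarrow> real \<Rightarrow> real \<Rightarrow> real \<Rightarrow> real \<Rightarrow> real) \<Rightarrow> (real \<Rightarrow> real \<Rightarrow> real) \<Rightarrow>
   (real \<Rightarrow> real \<Rightarrow> real) \<Rightarrow> (real \<Rightarrow> real) \<Rightarrow> (real \<Rightarrow> real) \<Rightarrow> bool"
where
  "bvp_solution f k0 k1 \<phi> u \<longleftrightarrow>
     C_n_on 4 {0..1} u \<and>
     (\<forall>x\<in>{0..1}. nth_deriv_on {0..1} 4 u x =
        f x (u x) (u (\<phi> x))
          (integral {0..1} (\<lambda>t. k0 x t * u t))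
          (integral {0..1} (\<lambda>t. k1 x t * u (\<phi> t)))) \<and>
     u 0 = 0 \<and> u 1 = 0 \<and>
     nth_deriv_on {0..1} 2 u 0 = 0 \<and> nth_deriv_on {0..1} 2 u 1 = 0"

lemma kernel_norm_attained:
  assumes k: "continuous_on ({0..1} \<times> {0..1}) (\<lambda>(x, s). k x s)"
  obtains x where "x \<in> {0..1}" "kernel_norm k = integral {0..1} (\<lambda>s. \<bar>k x s\<bar>)"
    "\<And>y. y \<in> {0..1} \<Longrightarrow> integral {0..1} (\<lambda>s. \<bar>k y s\<bar>) \<le> integral {0..1} (\<lambda>s. \<bar>k x s\<bar>)"
proof -
  let ?I = "\<lambda>x. integral {0..1} (\<lambda>s. \<bar>k x s\<bar>)"
  have "continuous_on ({0..1} \<times> cbox 0 1) (\<lambda>(x, s). \<bar>k x s\<bar>)"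
    using continuous_on_rabs[OF k] by (simp add: case_prod_unfold)
  from integral_continuous_on_param[OF this] have "continuous_on {0..1} ?I"
    by simp
  with continuous_attains_sup[of "{0..1::real}" ?I]
  obtain x where x: "x \<in> {0..1}" "\<forall>y\<in>{0..1}. ?I y \<le> ?I x"
    by auto
  then have "kernel_norm k = ?I x"
    unfolding kernel_norm_def by (intro cSup_eq_maximum) auto
  with x show thesis by (intro that) auto
qed

lemma integral_abs_green:
  assumes "x \<in> {0..1}"
  shows "integral {0..1} (\<lambda>s. \<bar>green x s\<bar>) = (x^4 - 2 * x^3 + x) / 24"
proof -
  have x: "0 \<le> x" "x \<le> 1" using assms by auto
  let ?p = "\<lambda>s. s * (x - 1) * (x\<^sup>2 - 2 * x + s\<^sup>2) / 6"
  let ?q = "\<lambda>s. x * (s - 1) * (s\<^sup>2 - 2 * s + x\<^sup>2) / 6"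
  let ?P = "\<lambda>s. (x - 1) * ((x\<^sup>2 - 2 * x) * s^2 / 2 + s^4 / 4) / 6"
  let ?Q = "\<lambda>s. x * (s^4 / 4 - s^3 + (x\<^sup>2 + 2) * s^2 / 2 - x\<^sup>2 * s) / 6"
  have aux: "a\<^sup>2 - 2 * a + b\<^sup>2 \<le> 0" if "0 \<le> b" "b \<le> a" "a \<le> 1" for a b :: real
  proof -
    have "b\<^sup>2 \<le> a\<^sup>2" using that by (intro power_mono)
    moreover have "a * a \<le> a * 1" using that by (intro mult_left_mono) auto
    ultimately show ?thesis by (simp add: power2_eq_square)
  qed
  have p: "0 \<le> ?p s" if "s \<in> {0..x}" for s
    using mult_nonpos_nonpos[of "s * (x - 1)" "x\<^sup>2 - 2 * x + s\<^sup>2"] aux[of s x] that x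
    by (auto simp: mult_nonneg_nonpos)
  have q: "0 \<le> ?q s" if "s \<in> {x..1}" for s
    using mult_nonpos_nonpos[of "x * (s - 1)" "s\<^sup>2 - 2 * s + x\<^sup>2"] aux[of x s] that x
    by (auto simp: mult_nonneg_nonpos)
  have "(?p has_integral (?P x - ?P 0)) {0..x}"
    using x by (intro fundamental_theorem_of_calculus)
      (auto intro!: derivative_eq_intros
        simp flip: has_real_derivative_iff_has_vector_derivative
        simp: field_simps power2_eq_square power3_eq_cube)
  then have 1: "((\<lambda>s. \<bar>green x s\<bar>) has_integral (?P x - ?P 0)) {0..x}"
  proof (rule has_integral_eq[rotated])
    show "?p s = \<bar>green x s\<bar>" if "s \<in> {0..x}" for s
      using p[OF that] that by (auto simp: green_def)
  qed
  have "(?q has_integral (?Q 1 - ?Q x)) {x..1}"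
    using x by (intro fundamental_theorem_of_calculus)
      (auto intro!: derivative_eq_intros
        simp flip: has_real_derivative_iff_has_vector_derivative
        simp: field_simps power2_eq_square power3_eq_cube)
  then have 2: "((\<lambda>s. \<bar>green x s\<bar>) has_integral (?Q 1 - ?Q x)) {x..1}"
  proof (rule has_integral_eq[rotated])
    show "?q s = \<bar>green x s\<bar>" if "s \<in> {x..1}" for s
      using q[OF that] that by (cases "s = x") (auto simp: green_def algebra_simps)
  qed
  have "?P x - ?P 0 + (?Q 1 - ?Q x) = (x^4 - 2 * x^3 + x) / 24"
    by (simp add: field_simps power2_eq_square power3_eq_cube power4_eq_xxxx)
  with has_integral_combine[OF x 1 2] show ?thesis
    by (metis integral_unique)
qed

lemma M0_eq: "M0 = 5 / 384"
  unfolding M0_def kernel_norm_def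
proof (rule cSup_eq_maximum)
  have "integral {0..1} (\<lambda>s. \<bar>green (1/2) s\<bar>) = 5 / 384"
    by (subst integral_abs_green) (auto simp: power_divide)
  then show "5 / 384 \<in> (\<lambda>x. integral {0..1} (\<lambda>s. \<bar>green x s\<bar>)) ` {0..1}"
    by (intro image_eqI[of _ _ "1/2"]) auto
next
  fix m assume "m \<in> (\<lambda>x. integral {0..1} (\<lambda>s. \<bar>green x s\<bar>)) ` {0..1}"
  then obtain x where x: "x \<in> {0..1}" "m = (x^4 - 2 * x^3 + x) / 24"
    by (auto simp: integral_abs_green)
  define w where "w = (x - 1/2)\<^sup>2"
  have "(x - 1/2)\<^sup>2 \<le> (1/2)\<^sup>2"
    using x by (intro abs_le_square_iff[THEN iffD1]) (auto simp: abs_if)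
  then have "w * w \<le> w * (1/4)"
    by (intro mult_left_mono) (auto simp: w_def power_divide)
  moreover have "0 \<le> w" by (simp add: w_def)
  moreover have "x^4 - 2 * x^3 + x = 5/16 - 3/2 * w + w * w"
    by (simp add: w_def field_simps power2_eq_square power3_eq_cube power4_eq_xxxx)
  ultimately have "x^4 - 2 * x^3 + x \<le> 5/16" by linarith
  then show "m \<le> 5 / 384" using x(2) by simp
qed

end

theory Submission
  imports Defs
begin

text \<open>
  The boundary value problem is equivalent to a fixed point equation for a contraction. Let
  \<open>T u x = integral {0..1} (\<lambda>s. green x s * rhs u s)\<close>, where \<open>rhs u\<close> is the right-hand side of
  the equation with \<open>u\<close> inserted. Repeated integration by parts shows that any four times
  differentiable \<open>u\<close> with the boundary conditions is the Green integral of its fourth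
  derivative (\<open>green_representation\<close>), so a solution is a fixed point of \<open>T\<close>. For the converse
  the Green integral is never differentiated: four successive antiderivatives of \<open>\<psi>\<close>,
  corrected by a cubic, solve the linear problem with right-hand side \<open>\<psi>\<close>
  (\<open>linear_bvp_solvable\<close>), and by the same representation this solution is the Green integral
  of \<open>\<psi>\<close>. Hence \<open>T u\<close> has fourth derivative \<open>rhs u\<close>, and a fixed point is a solution.

  Take \<open>u\<close> continuous with \<open>\<bar>u\<bar> \<le> M0 * M\<close>. The kernel bounds place all arguments of \<open>f\<close> in
  \<open>domain_D\<close>, so \<open>\<bar>rhs u\<bar> \<le> M\<close> and \<open>\<bar>T u\<bar> \<le> M0 * M\<close>: the operator maps this closed ball into
  itself. In the same way the Lipschitz condition on \<open>f\<close> yields the Lipschitz constant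
  \<open>(L0 + L1 + L2 * kernel_norm k0 + L3 * kernel_norm k1) * M0 < 1\<close> for \<open>T\<close> in the supremum
  norm (\<open>green_op_contraction\<close>). Banach's fixed point theorem gives existence; uniqueness follows
  by applying the contraction estimate at a point where the difference of two solutions is
  largest.
\<close>

section \<open>Chains of derivatives on the unit interval\<close>

text \<open>Derivatives carried as explicit witnesses can be handled by derivative rules, which the
  iterated choice operator behind \<open>nth_deriv_on\<close> does not permit directly.\<close>

definition derivative_chain :: "nat \<Rightarrow> (nat \<Rightarrow> real \<Rightarrow> real) \<Rightarrow> bool" where
  "derivative_chain n d \<longleftrightarrow>
     (\<forall>j<n. \<forall>x\<in>{0..1}. (d j has_real_derivative d (Suc j) x) (at x within {0..1}))"

lemma derivative_chainD:
  "derivative_chain n d \<Longrightarrow> j < n \<Longrightarrow> x \<in> {0..1} \<Longrightarrow>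
     (d j has_real_derivative d (Suc j) x) (at x within {0..1})"
  by (auto simp: derivative_chain_def)

lemma C_n_on_imp_derivative_chain:
  assumes "C_n_on n {0..1} u"
  shows "derivative_chain n (\<lambda>j. nth_deriv_on {0..1} j u)"
proof -
  have "(nth_deriv_on {0..1} j u has_real_derivative nth_deriv_on {0..1} (Suc j) u x)
      (at x within {0..1})" if "j < n" "x \<in> {0..1}" for j x
  proof -
    have "nth_deriv_on {0..1} j u differentiable at x within {0..1}"
      using assms that by (auto simp: C_n_on_def differentiable_on_def)
    then show ?thesis
      by (simp add: nth_deriv_on_def vector_derivative_works
          has_real_derivative_iff_has_vector_derivative)
  qed
  then show ?thesis by (simp add: derivative_chain_def)
qed

lemma nth_deriv_on_eq_derivative_chain:
  assumes d: "derivative_chain n d" and u: "\<And>x. x \<in> {0..1} \<Longrightarrow> u x = d 0 x"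
    and "j \<le> n" "x \<in> {0..1}"
  shows "nth_deriv_on {0..1} j u x = d j x"
  using assms(3,4)
proof (induction j arbitrary: x)
  case 0
  then show ?case by (simp add: nth_deriv_on_def u)
next
  case (Suc j)
  have "(d j has_real_derivative d (Suc j) x) (at x within {0..1})"
    using d Suc.prems by (intro derivative_chainD) auto
  then have "(nth_deriv_on {0..1} j u has_real_derivative d (Suc j) x) (at x within {0..1})"
    by (rule has_field_derivative_transform_within[OF _ zero_less_one Suc.prems(2)])
      (use Suc in auto)
  then show ?case
    using vector_derivative_within_closed_interval[of 0 1 x] Suc.prems
    by (simp add: nth_deriv_on_def has_real_derivative_iff_has_vector_derivative)
qed

lemma derivative_chain_imp_C_n_on:
  assumes d: "derivative_chain n d" and u: "\<And>x. x \<in> {0..1} \<Longrightarrow> u x = d 0 x"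
    and cont: "continuous_on {0..1} (d n)"
  shows "C_n_on n {0..1} u"
proof -
  have "nth_deriv_on {0..1} j u differentiable_on {0..1}" if j: "j < n" for j
  proof -
    have "(nth_deriv_on {0..1} j u has_real_derivative d (Suc j) x) (at x within {0..1})"
      if x: "x \<in> {0..1}" for x
      using nth_deriv_on_eq_derivative_chain[OF d u] j
      by (intro has_field_derivative_transform_within[OF derivative_chainD[OF d j x] zero_less_one x])
        auto
    then show ?thesis
      by (meson differentiable_on_def differentiableI has_field_derivative_imp_has_derivative)
  qed
  moreover have "continuous_on {0..1} (nth_deriv_on {0..1} n u)"
    using cont nth_deriv_on_eq_derivative_chain[OF d u, of n]
    by (subst continuous_on_cong[OF refl, of _ _ "d n"]) auto
  ultimately show ?thesis by (simp add: C_n_on_def)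
qed

section \<open>The linear problem and its Green function\<close>

lemma iterated_antiderivative_exists:
  assumes "continuous_on {0..1} \<psi>"
  shows "\<exists>d. derivative_chain n d \<and> d n = \<psi>"
  using assms
proof (induction n arbitrary: \<psi>)
  case 0
  then show ?case by (intro exI[of _ "\<lambda>_. \<psi>"]) (simp add: derivative_chain_def)
next
  case (Suc n)
  obtain A where "\<And>x. x \<in> {0..1} \<Longrightarrow> (A has_vector_derivative \<psi> x) (at x within {0..1})"
    using antiderivative_continuous[OF Suc.prems] by blast
  then have A: "\<And>x. x \<in> {0..1} \<Longrightarrow> (A has_real_derivative \<psi> x) (at x within {0..1})"
    by (simp add: has_real_derivative_iff_has_vector_derivative)
  then have "continuous_on {0..1} A"
    by (rule DERIV_continuous_on)
  then obtain d where d: "derivative_chain n d" "d n = A"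
    using Suc.IH by blast
  show ?case
    using d A by (intro exI[of _ "d(Suc n := \<psi>)"]) (auto simp: derivative_chain_def less_Suc_eq)
qed

text \<open>Adding a cubic polynomial to a fourfold antiderivative leaves the fourth derivative
  unchanged, and its four coefficients can be chosen to meet the four boundary conditions.\<close>

lemma linear_bvp_solvable:
  assumes "continuous_on {0..1} \<psi>"
  obtains d where "derivative_chain 4 d" "d 4 = \<psi>"
    "d 0 0 = 0" "d 0 1 = 0" "d 2 0 = 0" "d 2 1 = 0"
proof -
  obtain d where d: "derivative_chain 4 d" "d 4 = \<psi>"
    using iterated_antiderivative_exists[OF assms] by blast
  \<comment> \<open>The second derivative of the cubic is \<open>a * x + b\<close>, so the conditions on \<open>d 2\<close> fix \<open>a\<close> and
    \<open>b\<close>; those on \<open>d 0\<close> then fix \<open>e\<close> and \<open>c\<close>.\<close>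
  define b where "b = - d 2 0"
  define a where "a = - d 2 1 - b"
  define e where "e = - d 0 0"
  define c where "c = - d 0 1 - a / 6 - b / 2 - e"
  define p where "p j x = [a * x^3 / 6 + b * x\<^sup>2 / 2 + c * x + e, a * x\<^sup>2 / 2 + b * x + c,
      a * x + b, a, 0] ! j" for j :: nat and x
  have "(p j has_real_derivative p (Suc j) x) (at x within {0..1})" if "j < 4" for j x
  proof -
    have "j = 0 \<or> j = 1 \<or> j = 2 \<or> j = 3"
      using that by arith
    then show ?thesis
      unfolding p_def by (elim disjE) (auto intro!: derivative_eq_intros simp: power2_eq_square numeral_eq_Suc)
  qed
  with d have "derivative_chain 4 (\<lambda>j x. d j x + p j x)"
    by (auto simp: derivative_chain_def intro!: derivative_intros)
  then show thesis
    by (rule that) (auto simp: d p_def a_def b_def c_def e_def)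
qed

text \<open>Integrating by parts four times against a cubic \<open>p\<close> leaves only boundary terms, because the
  fourth derivative of \<open>p\<close> vanishes; \<open>c\<close> is its constant third derivative.\<close>

lemma has_integral_parts_cubic:
  assumes d: "derivative_chain 4 d"
    and p: "\<And>s. (p has_real_derivative p' s) (at s)" "\<And>s. (p' has_real_derivative p'' s) (at s)"
      "\<And>s. (p'' has_real_derivative c) (at s)"
    and ab: "a \<le> b" "{a..b} \<subseteq> {0..1}"
  shows "((\<lambda>s. p s * d 4 s) has_integral
      (p b * d 3 b - p' b * d 2 b + p'' b * d 1 b - c * d 0 b)
      - (p a * d 3 a - p' a * d 2 a + p'' a * d 1 a - c * d 0 a)) {a..b}"
proof (intro fundamental_theorem_of_calculus ab(1))
  fix s assume s: "s \<in> {a..b}"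
  have D: "(d j has_real_derivative d (Suc j) s) (at s within {a..b})" if "j < 4" for j
    using derivative_chainD[OF d that, of s] ab(2) s
    by (meson has_field_derivative_subset subsetD)
  note [derivative_intros] = D[of 0] D[of 1] D[of 2] D[of 3]
    has_field_derivative_at_within[OF p(1)] has_field_derivative_at_within[OF p(2)]
    has_field_derivative_at_within[OF p(3)]
  show "((\<lambda>s. p s * d 3 s - p' s * d 2 s + p'' s * d 1 s - c * d 0 s)
      has_vector_derivative p s * d 4 s) (at s within {a..b})"
    unfolding has_real_derivative_iff_has_vector_derivative[symmetric]
    by (rule derivative_eq_intros refl | simp)+
       (simp add: eval_nat_numeral algebra_simps)
qed

text \<open>In the variable \<open>s\<close> the Green function is one cubic on \<open>{0..x}\<close> and another on \<open>{x..1}\<close>.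
  Values and second derivatives of these cubics vanish at the respective outer endpoint, which
  together with the boundary conditions annihilates the boundary terms there. At \<open>s = x\<close> the
  two cubics agree up to the second derivative, while the third derivative jumps by one, from
  \<open>x - 1\<close> to \<open>x\<close>. Only \<open>d 0 x\<close> survives.\<close>

lemma green_representation:
  assumes d: "derivative_chain 4 d"
    and bc: "d 0 0 = 0" "d 0 1 = 0" "d 2 0 = 0" "d 2 1 = 0"
    and x: "x \<in> {0..1}"
  shows "((\<lambda>s. green x s * d 4 s) has_integral d 0 x) {0..1}"
proof -
  let ?p = "\<lambda>s. s * (x - 1) * (x\<^sup>2 - 2 * x + s\<^sup>2) / 6"
  let ?p' = "\<lambda>s. (x - 1) * (x\<^sup>2 - 2 * x + 3 * s\<^sup>2) / 6"
  let ?p'' = "\<lambda>s. (x - 1) * s"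
  let ?q = "\<lambda>s. x * (s - 1) * (s\<^sup>2 - 2 * s + x\<^sup>2) / 6"
  let ?q' = "\<lambda>s. x * (3 * s\<^sup>2 - 6 * s + 2 + x\<^sup>2) / 6"
  let ?q'' = "\<lambda>s. x * (s - 1)"
  let ?B = "\<lambda>p p' p'' c s. p s * d 3 s - p' s * d 2 s + p'' s * d 1 s - c * d 0 s"
  have "((\<lambda>s. ?p s * d 4 s) has_integral ?B ?p ?p' ?p'' (x - 1) x - ?B ?p ?p' ?p'' (x - 1) 0) {0..x}"
    using x by (intro has_integral_parts_cubic[OF d])
      (auto intro!: derivative_eq_intros simp: field_simps power2_eq_square)
  then have 1: "((\<lambda>s. green x s * d 4 s) has_integral
      ?B ?p ?p' ?p'' (x - 1) x - ?B ?p ?p' ?p'' (x - 1) 0) {0..x}"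
    by (rule has_integral_eq[rotated]) (auto simp: green_def)
  have "((\<lambda>s. ?q s * d 4 s) has_integral ?B ?q ?q' ?q'' x 1 - ?B ?q ?q' ?q'' x x) {x..1}"
    using x by (intro has_integral_parts_cubic[OF d])
      (auto intro!: derivative_eq_intros simp: field_simps power2_eq_square)
  then have 2: "((\<lambda>s. green x s * d 4 s) has_integral
      ?B ?q ?q' ?q'' x 1 - ?B ?q ?q' ?q'' x x) {x..1}"
  proof (rule has_integral_eq[rotated])
    show "?q s * d 4 s = green x s * d 4 s" if "s \<in> {x..1}" for s
      using that by (cases "s = x") (auto simp: green_def algebra_simps)
  qed
  have "(?B ?p ?p' ?p'' (x - 1) x - ?B ?p ?p' ?p'' (x - 1) 0)
      + (?B ?q ?q' ?q'' x 1 - ?B ?q ?q' ?q'' x x) = d 0 x"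
    by (simp add: bc field_simps power2_eq_square)
  with has_integral_combine[OF _ _ 1 2] x show ?thesis by simp
qed

section \<open>Integral operators with continuous kernels\<close>

text \<open>Both branches of the Green function are one polynomial in \<open>min x s\<close> and \<open>max x s\<close>.\<close>

lemma continuous_on_green: "continuous_on S (\<lambda>(x, s). green x s)"
proof -
  have "green x s = min x s * (max x s - 1) * ((max x s)\<^sup>2 - 2 * max x s + (min x s)\<^sup>2) / 6" for x s
    by (simp add: green_def min_def max_def)
  then show ?thesis
    by (simp only: case_prod_unfold) (intro continuous_intros, auto)
qed

lemma kernel_norm_upper:
  assumes "continuous_on ({0..1} \<times> {0..1}) (\<lambda>(x, s). k x s)" "x \<in> {0..1}"
  shows "integral {0..1} (\<lambda>s. \<bar>k x s\<bar>) \<le> kernel_norm k"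
  using kernel_norm_attained[OF assms(1)] assms(2) by metis

lemma kernel_norm_nonneg:
  assumes "continuous_on ({0..1} \<times> {0..1}) (\<lambda>(x, s). k x s)"
  shows "0 \<le> kernel_norm k"
  using kernel_norm_attained[OF assms] by (metis abs_ge_zero integral_nonneg integrable_on_def
    not_integrable_integral order_refl)

lemma continuous_on_kernel_section:
  fixes k :: "real \<Rightarrow> real \<Rightarrow> real"
  assumes "continuous_on ({0..1} \<times> {0..1}) (\<lambda>(x, s). k x s)" "x \<in> {0..1}"
  shows "continuous_on {0..1} (k x)"
proof -
  have "continuous_on {0..1} (\<lambda>s. case (x, s) of (x, s) \<Rightarrow> k x s)"
    by (rule continuous_on_compose2[OF assms(1)]) (use assms(2) in \<open>auto intro!: continuous_intros\<close>)
  then show ?thesis by simp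
qed

lemma abs_integral_kernel_le:
  assumes k: "continuous_on ({0..1} \<times> {0..1}) (\<lambda>(x, s). k x s)" and x: "x \<in> {0..1}"
    and h: "continuous_on {0..1} h" and c: "\<And>s. s \<in> {0..1} \<Longrightarrow> \<bar>h s\<bar> \<le> c"
  shows "\<bar>integral {0..1} (\<lambda>s. k x s * h s)\<bar> \<le> kernel_norm k * c"
proof -
  note [continuous_intros] = continuous_on_kernel_section[OF k x] h
  have "0 \<le> c" using c[of 0] by simp
  have "\<bar>integral {0..1} (\<lambda>s. k x s * h s)\<bar> \<le> integral {0..1} (\<lambda>s. \<bar>k x s\<bar> * c)"
    unfolding real_norm_def[symmetric]
    by (intro integral_norm_bound_integral integrable_continuous_real continuous_intros)
      (auto simp: abs_mult intro!: mult_left_mono c)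
  also have "\<dots> = integral {0..1} (\<lambda>s. \<bar>k x s\<bar>) * c"
    by simp
  also have "\<dots> \<le> kernel_norm k * c"
    by (intro mult_right_mono kernel_norm_upper k x \<open>0 \<le> c\<close>)
  finally show ?thesis .
qed

lemma continuous_on_integral_kernel:
  fixes k :: "real \<Rightarrow> real \<Rightarrow> real"
  assumes k: "continuous_on ({0..1} \<times> {0..1}) (\<lambda>(x, s). k x s)"
    and h: "continuous_on {0..1} h"
  shows "continuous_on {0..1} (\<lambda>x. integral {0..1} (\<lambda>s. k x s * h s))"
proof -
  have "continuous_on ({0..1} \<times> {0..1}) (\<lambda>z. h (snd z))"
    by (rule continuous_on_compose2[OF h]) (auto intro!: continuous_intros)
  then have "continuous_on ({0..1} \<times> cbox 0 1) (\<lambda>(x, s). k x s * h s)"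
    using k unfolding case_prod_unfold box_real by (intro continuous_on_mult)
  from integral_continuous_on_param[OF this] show ?thesis by simp
qed


section \<open>The fixed point operator\<close>

locale fourth_order_bvp =
  fixes f :: "real \<Rightarrow> real \<Rightarrow> real \<Rightarrow> real \<Rightarrow> real \<Rightarrow> real"
    and k0 k1 :: "real \<Rightarrow> real \<Rightarrow> real"
    and \<phi> :: "real \<Rightarrow> real"
    and M L0 L1 L2 L3 :: real
  assumes k0: "continuous_on ({0..1} \<times> {0..1}) (\<lambda>(x, t). k0 x t)"
    and k1: "continuous_on ({0..1} \<times> {0..1}) (\<lambda>(x, t). k1 x t)"
    and phi: "continuous_on {0..1} \<phi>" "\<phi> ` {0..1} \<subseteq> {0..1}"
    and M_pos: "M > 0"
    and L: "L0 \<ge> 0" "L1 \<ge> 0" "L2 \<ge> 0" "L3 \<ge> 0"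
    and f_cont: "continuous_on (domain_D k0 k1 M) (\<lambda>(x, u, y, v, z). f x u y v z)"
    and f_bound: "\<And>x u y v z. (x, u, y, v, z) \<in> domain_D k0 k1 M \<Longrightarrow> \<bar>f x u y v z\<bar> \<le> M"
    and f_lip: "\<And>x u1 y1 v1 z1 u2 y2 v2 z2.
        (x, u1, y1, v1, z1) \<in> domain_D k0 k1 M \<Longrightarrow> (x, u2, y2, v2, z2) \<in> domain_D k0 k1 M \<Longrightarrow>
        \<bar>f x u2 y2 v2 z2 - f x u1 y1 v1 z1\<bar>
          \<le> L0 * \<bar>u2 - u1\<bar> + L1 * \<bar>y2 - y1\<bar> + L2 * \<bar>v2 - v1\<bar> + L3 * \<bar>z2 - z1\<bar>"
    and contraction: "(L0 + L1 + L2 * kernel_norm k0 + L3 * kernel_norm k1) * M0 < 1"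
begin

definition rhs :: "(real \<Rightarrow> real) \<Rightarrow> real \<Rightarrow> real" where
  "rhs u x = f x (u x) (u (\<phi> x))
     (integral {0..1} (\<lambda>t. k0 x t * u t)) (integral {0..1} (\<lambda>t. k1 x t * u (\<phi> t)))"

definition admissible :: "(real \<Rightarrow> real) \<Rightarrow> bool" where
  "admissible u \<longleftrightarrow> continuous_on {0..1} u \<and> (\<forall>x\<in>{0..1}. \<bar>u x\<bar> \<le> M0 * M)"

definition green_op :: "(real \<Rightarrow> real) \<Rightarrow> real \<Rightarrow> real" where
  "green_op u x = integral {0..1} (\<lambda>s. green x s * rhs u s)"

abbreviation "q \<equiv> (L0 + L1 + L2 * kernel_norm k0 + L3 * kernel_norm k1) * M0"

lemma phi_mem: "x \<in> {0..1} \<Longrightarrow> \<phi> x \<in> {0..1}"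
  using phi(2) by (meson image_subset_iff)

lemma continuous_on_comp_phi:
  "continuous_on {0..1} u \<Longrightarrow> continuous_on {0..1} (\<lambda>x. u (\<phi> x))"
  by (rule continuous_on_compose2[OF _ phi])

lemma q_nonneg: "0 \<le> q"
  using L kernel_norm_nonneg[OF k0] kernel_norm_nonneg[OF k1] by (simp add: M0_eq)

text \<open>The bounds in \<open>domain_D\<close> are exactly those which the kernel norms give for functions bounded
  by \<open>M0 * M\<close>, so \<open>f\<close> is evaluated only where it is controlled.\<close>

lemma arguments_in_domain:
  assumes "admissible u" "x \<in> {0..1}"
  shows "(x, u x, u (\<phi> x), integral {0..1} (\<lambda>t. k0 x t * u t),
    integral {0..1} (\<lambda>t. k1 x t * u (\<phi> t))) \<in> domain_D k0 k1 M"
  using assms abs_integral_kernel_le[OF k0 assms(2), of u "M0 * M"]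
    abs_integral_kernel_le[OF k1 assms(2), of "\<lambda>t. u (\<phi> t)" "M0 * M"]
    continuous_on_comp_phi[of u] phi_mem
  by (auto simp: domain_D_def admissible_def mult_ac)

lemma continuous_on_rhs:
  assumes "admissible u"
  shows "continuous_on {0..1} (rhs u)"
proof -
  have u: "continuous_on {0..1} u"
    using assms by (simp add: admissible_def)
  have "continuous_on {0..1} (\<lambda>x. (x, u x, u (\<phi> x), integral {0..1} (\<lambda>t. k0 x t * u t),
    integral {0..1} (\<lambda>t. k1 x t * u (\<phi> t))))"
    by (intro continuous_intros u continuous_on_comp_phi continuous_on_integral_kernel k0 k1)
  then have "continuous_on {0..1} (\<lambda>x. case (x, u x, u (\<phi> x), integral {0..1} (\<lambda>t. k0 x t * u t),
      integral {0..1} (\<lambda>t. k1 x t * u (\<phi> t))) of (x, u, y, v, z) \<Rightarrow> f x u y v z)"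
    by (rule continuous_on_compose2[OF f_cont]) (intro image_subsetI arguments_in_domain assms)
  then show ?thesis by (simp add: rhs_def[abs_def])
qed

lemma abs_rhs_le: "admissible u \<Longrightarrow> x \<in> {0..1} \<Longrightarrow> \<bar>rhs u x\<bar> \<le> M"
  unfolding rhs_def by (intro f_bound arguments_in_domain)

lemma rhs_lipschitz:
  assumes u: "admissible u" and w: "admissible w" and x: "x \<in> {0..1}"
    and c: "\<And>t. t \<in> {0..1} \<Longrightarrow> \<bar>u t - w t\<bar> \<le> c"
  shows "\<bar>rhs u x - rhs w x\<bar> \<le> (L0 + L1 + L2 * kernel_norm k0 + L3 * kernel_norm k1) * c"
proof -
  note cont = u[unfolded admissible_def, THEN conjunct1] w[unfolded admissible_def, THEN conjunct1]
  have diff: "\<bar>integral {0..1} (\<lambda>t. k x t * g t) - integral {0..1} (\<lambda>t. k x t * h t)\<bar> \<le> kernel_norm k * c"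
    if k: "continuous_on ({0..1} \<times> {0..1}) (\<lambda>(x, t). k x t)"
      and gh: "continuous_on {0..1} g" "continuous_on {0..1} h"
      and le: "\<And>t. t \<in> {0..1} \<Longrightarrow> \<bar>g t - h t\<bar> \<le> c" for k g h
  proof -
    have "(\<lambda>t. k x t * g t) integrable_on {0..1}" "(\<lambda>t. k x t * h t) integrable_on {0..1}"
      by (intro integrable_continuous_real continuous_intros continuous_on_kernel_section[OF k x] gh)+
    then have "integral {0..1} (\<lambda>t. k x t * g t) - integral {0..1} (\<lambda>t. k x t * h t)
        = integral {0..1} (\<lambda>t. k x t * (g t - h t))"
      by (simp add: right_diff_distrib integral_diff)
    then show ?thesis
      using abs_integral_kernel_le[OF k x, of "\<lambda>t. g t - h t" c] le gh
      by (simp add: continuous_intros)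
  qed
  have "\<bar>rhs u x - rhs w x\<bar> \<le> L0 * \<bar>u x - w x\<bar> + L1 * \<bar>u (\<phi> x) - w (\<phi> x)\<bar>
      + L2 * \<bar>integral {0..1} (\<lambda>t. k0 x t * u t) - integral {0..1} (\<lambda>t. k0 x t * w t)\<bar>
      + L3 * \<bar>integral {0..1} (\<lambda>t. k1 x t * u (\<phi> t)) - integral {0..1} (\<lambda>t. k1 x t * w (\<phi> t))\<bar>"
    unfolding rhs_def by (intro f_lip arguments_in_domain u w x)
  also have "\<dots> \<le> L0 * c + L1 * c + L2 * (kernel_norm k0 * c) + L3 * (kernel_norm k1 * c)"
    by (intro add_mono mult_left_mono L c x phi_mem diff k0 k1 cont continuous_on_comp_phi)
  finally show ?thesis by (simp add: algebra_simps)
qed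

text \<open>The linear problem has some solution, and by the Green representation every solution of it
  equals the Green integral of the right-hand side.\<close>

lemma green_op_solves_linear_problem:
  assumes u: "admissible u"
  obtains d where "derivative_chain 4 d" "d 4 = rhs u"
    "d 0 0 = 0" "d 0 1 = 0" "d 2 0 = 0" "d 2 1 = 0"
    "\<And>x. x \<in> {0..1} \<Longrightarrow> green_op u x = d 0 x"
proof -
  obtain d where d: "derivative_chain 4 d" "d 4 = rhs u"
    "d 0 0 = 0" "d 0 1 = 0" "d 2 0 = 0" "d 2 1 = 0"
    using linear_bvp_solvable[OF continuous_on_rhs[OF u]] .
  moreover have "green_op u x = d 0 x" if "x \<in> {0..1}" for x
    using integral_unique[OF green_representation[OF d(1,3-6) that]]
    by (simp add: green_op_def d(2))
  ultimately show thesis by (rule that)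
qed

lemma bvp_solution_iff_fixed_point:
  assumes w: "admissible w"
  shows "bvp_solution f k0 k1 \<phi> w \<longleftrightarrow> (\<forall>x\<in>{0..1}. green_op w x = w x)"
proof
  assume sol: "bvp_solution f k0 k1 \<phi> w"
  let ?d = "\<lambda>j. nth_deriv_on {0..1} j w"
  have chain: "derivative_chain 4 ?d"
    using sol by (intro C_n_on_imp_derivative_chain) (simp add: bvp_solution_def)
  have bc: "?d 0 0 = 0" "?d 0 1 = 0" "?d 2 0 = 0" "?d 2 1 = 0"
    using sol by (auto simp: bvp_solution_def nth_deriv_on_def)
  show "\<forall>x\<in>{0..1}. green_op w x = w x"
  proof
    fix x :: real assume "x \<in> {0..1}"
    then have "((\<lambda>s. green x s * ?d 4 s) has_integral ?d 0 x) {0..1}"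
      by (intro green_representation chain bc)
    then have "((\<lambda>s. green x s * rhs w s) has_integral ?d 0 x) {0..1}"
      by (rule has_integral_eq[rotated]) (use sol in \<open>auto simp: bvp_solution_def rhs_def\<close>)
    then show "green_op w x = w x"
      by (simp add: green_op_def integral_unique nth_deriv_on_def)
  qed
next
  assume fixed: "\<forall>x\<in>{0..1}. green_op w x = w x"
  obtain d where d: "derivative_chain 4 d" "d 4 = rhs w"
    "d 0 0 = 0" "d 0 1 = 0" "d 2 0 = 0" "d 2 1 = 0"
    "\<And>x. x \<in> {0..1} \<Longrightarrow> green_op w x = d 0 x"
    by (rule green_op_solves_linear_problem[OF w]) (rule that)
  have w_eq: "w x = d 0 x" if "x \<in> {0..1}" for x
    using fixed d(7) that by auto
  note deriv = nth_deriv_on_eq_derivative_chain[OF d(1) w_eq]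
  have "C_n_on 4 {0..1} w"
    using derivative_chain_imp_C_n_on[OF d(1) w_eq] continuous_on_rhs[OF w] d(2) by simp
  then show "bvp_solution f k0 k1 \<phi> w"
    using d(2-6) deriv w_eq by (auto simp: bvp_solution_def rhs_def)
qed

text \<open>The radius \<open>M0 * M\<close> is preserved because \<open>\<bar>rhs u\<bar> \<le> M\<close> and \<open>M0\<close> is the kernel norm of the
  Green function.\<close>

lemma green_op_admissible:
  assumes u: "admissible u"
  shows "admissible (green_op u)"
proof -
  obtain d where d: "derivative_chain 4 d" "\<And>x. x \<in> {0..1} \<Longrightarrow> green_op u x = d 0 x"
    by (rule green_op_solves_linear_problem[OF u]) (rule that)
  have "continuous_on {0..1} (d 0)"
    by (rule DERIV_continuous_on[OF derivative_chainD[OF d(1)]]) simp_all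
  then have "continuous_on {0..1} (green_op u)"
    by (subst continuous_on_cong[OF refl d(2)])
  moreover have "\<bar>green_op u x\<bar> \<le> M0 * M" if "x \<in> {0..1}" for x
    unfolding green_op_def M0_def
    using u that by (intro abs_integral_kernel_le continuous_on_green continuous_on_rhs abs_rhs_le)
  ultimately show ?thesis by (simp add: admissible_def)
qed

lemma green_op_contraction:
  assumes u: "admissible u" and w: "admissible w" and x: "x \<in> {0..1}"
    and c: "\<And>t. t \<in> {0..1} \<Longrightarrow> \<bar>u t - w t\<bar> \<le> c"
  shows "\<bar>green_op u x - green_op w x\<bar> \<le> q * c"
proof -
  note cont = continuous_on_rhs[OF u] continuous_on_rhs[OF w]
  have green: "continuous_on {0..1} (green x)"
    by (rule continuous_on_kernel_section[OF continuous_on_green x])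
  have "(\<lambda>s. green x s * rhs u s) integrable_on {0..1}" "(\<lambda>s. green x s * rhs w s) integrable_on {0..1}"
    by (intro integrable_continuous_real continuous_on_mult green cont)+
  then have "green_op u x - green_op w x = integral {0..1} (\<lambda>s. green x s * (rhs u s - rhs w s))"
    by (simp add: green_op_def right_diff_distrib integral_diff)
  moreover have "\<bar>integral {0..1} (\<lambda>s. green x s * (rhs u s - rhs w s))\<bar>
      \<le> kernel_norm green * ((L0 + L1 + L2 * kernel_norm k0 + L3 * kernel_norm k1) * c)"
  proof (rule abs_integral_kernel_le[OF continuous_on_green x])
    show "continuous_on {0..1} (\<lambda>s. rhs u s - rhs w s)"
      by (rule continuous_on_diff[OF cont])
    show "\<bar>rhs u s - rhs w s\<bar> \<le> (L0 + L1 + L2 * kernel_norm k0 + L3 * kernel_norm k1) * c"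
      if "s \<in> {0..1}" for s
      by (rule rhs_lipschitz[OF u w that c])
  qed
  ultimately show ?thesis by (simp add: M0_def mult_ac)
qed

text \<open>Banach's theorem is applied in the complete space of bounded continuous functions on the
  whole line. A function on the unit interval enters this space by being extended as a constant
  beyond each endpoint, that is, by composition with \<open>clamp 0 1\<close>.\<close>

lemma fixed_point_exists: "\<exists>u. admissible u \<and> (\<forall>x\<in>{0..1}. green_op u x = u x)"
proof -
  define S :: "(real \<Rightarrow>\<^sub>C real) set" where "S = PiC {0..1} (\<lambda>_. {- (M0 * M)..M0 * M})"
  have S: "g \<in> S \<longleftrightarrow> admissible g" for g
    by (auto simp: S_def mem_PiC_iff admissible_def abs_le_iff Pi_iff minus_le_iff)
  have "\<exists>h :: real \<Rightarrow>\<^sub>C real. \<forall>x. h x = green_op g (clamp 0 1 x)" if "g \<in> S" for g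
    using continuous_on_cbox_bcontfunE[of 0 1 "green_op g"] green_op_admissible[of g] that
    by (metis S admissible_def box_real(2))
  then obtain F :: "(real \<Rightarrow>\<^sub>C real) \<Rightarrow> (real \<Rightarrow>\<^sub>C real)"
    where F: "F g x = green_op g (clamp 0 1 x)" if "g \<in> S" for g x
    by metis
  have F_eq: "F g x = green_op g x" if "g \<in> S" "x \<in> {0..1}" for g x
    using F[OF that(1)] that(2) by simp
  have clamp_mem: "clamp 0 1 x \<in> {0..1}" for x :: real
    using clamp_in_interval[of 0 1 x] by simp
  have "\<exists>!g\<in>S. F g = g"
  proof (rule Banach_fix[OF _ _ q_nonneg contraction])
    show "complete S"
      unfolding S_def complete_eq_closed by (intro closed_PiC) auto
    have "0 \<in> S"
      unfolding S using M_pos by (simp add: admissible_def M0_eq)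
    then show "S \<noteq> {}" by blast
    show "F ` S \<subseteq> S"
    proof safe
      fix g assume g: "g \<in> S"
      then have "admissible (green_op g)"
        using S green_op_admissible by simp
      then show "F g \<in> S"
        unfolding S by (simp add: admissible_def F_eq[OF g])
    qed
    show "dist (F g) (F h) \<le> q * dist g h" if "g \<in> S" "h \<in> S" for g h
    proof (rule dist_bound)
      fix x
      show "dist (F g x) (F h x) \<le> q * dist g h"
        unfolding F[OF that(1)] F[OF that(2)] dist_real_def
        using that S dist_bounded[of g _ h]
        by (intro green_op_contraction clamp_mem) (auto simp: dist_real_def)
    qed
  qed
  then obtain g where "g \<in> S" "F g = g" by blast
  then show ?thesis using F_eq S by metis
qed

lemma fixed_point_unique:
  assumes u: "admissible u" "\<forall>x\<in>{0..1}. green_op u x = u x"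
    and w: "admissible w" "\<forall>x\<in>{0..1}. green_op w x = w x"
    and x: "x \<in> {0..1}"
  shows "w x = u x"
proof -
  have "continuous_on {0..1} (\<lambda>t. \<bar>u t - w t\<bar>)"
    using u w by (intro continuous_intros) (auto simp: admissible_def)
  then obtain y where y: "y \<in> {0..1}" "\<And>t. t \<in> {0..1} \<Longrightarrow> \<bar>u t - w t\<bar> \<le> \<bar>u y - w y\<bar>"
    using continuous_attains_sup[of "{0..1::real}" "\<lambda>t. \<bar>u t - w t\<bar>"] by auto
  have "\<bar>u y - w y\<bar> \<le> q * \<bar>u y - w y\<bar>"
    using green_op_contraction[OF u(1) w(1) y] u(2) w(2) y(1) by simp
  then have "(1 - q) * \<bar>u y - w y\<bar> \<le> 0"
    by (simp add: left_diff_distrib)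
  then have "\<bar>u y - w y\<bar> = 0"
    using contraction by (simp add: mult_le_0_iff)
  then show ?thesis using y(2)[OF x] by simp
qed

end

section \<open>Existence and uniqueness\<close>

theorem theorem2p2:
  fixes f :: "real \<Rightarrow> real \<Rightarrow> real \<Rightarrow> real \<Rightarrow> real \<Rightarrow> real"
    and k0 k1 :: "real \<Rightarrow> real \<Rightarrow> real"
    and \<phi> :: "real \<Rightarrow> real"
    and M L0 L1 L2 L3 :: real
  assumes k0: "continuous_on ({0..1} \<times> {0..1}) (\<lambda>(x, t). k0 x t)"
    and k1: "continuous_on ({0..1} \<times> {0..1}) (\<lambda>(x, t). k1 x t)"
    and phi: "continuous_on {0..1} \<phi>" "\<phi> ` {0..1} \<subseteq> {0..1}"
    and M: "M > 0"
    and L: "L0 \<ge> 0" "L1 \<ge> 0" "L2 \<ge> 0" "L3 \<ge> 0"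
    and f_cont: "continuous_on (domain_D k0 k1 M) (\<lambda>(x, u, y, v, z). f x u y v z)"
    and f_bound: "\<And>x u y v z. (x, u, y, v, z) \<in> domain_D k0 k1 M \<Longrightarrow> \<bar>f x u y v z\<bar> \<le> M"
    and f_lip: "\<And>x u1 y1 v1 z1 u2 y2 v2 z2.
        (x, u1, y1, v1, z1) \<in> domain_D k0 k1 M \<Longrightarrow> (x, u2, y2, v2, z2) \<in> domain_D k0 k1 M \<Longrightarrow>
        \<bar>f x u2 y2 v2 z2 - f x u1 y1 v1 z1\<bar>
          \<le> L0 * \<bar>u2 - u1\<bar> + L1 * \<bar>y2 - y1\<bar> + L2 * \<bar>v2 - v1\<bar> + L3 * \<bar>z2 - z1\<bar>"
    and q: "(L0 + L1 + L2 * kernel_norm k0 + L3 * kernel_norm k1) * M0 < 1"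
  shows "\<exists>u. (bvp_solution f k0 k1 \<phi> u \<and> (\<forall>x\<in>{0..1}. \<bar>u x\<bar> \<le> M0 * M)) \<and>
    (\<forall>w. bvp_solution f k0 k1 \<phi> w \<and> (\<forall>x\<in>{0..1}. \<bar>w x\<bar> \<le> M0 * M) \<longrightarrow>
         (\<forall>x\<in>{0..1}. w x = u x))"
proof -
  interpret fourth_order_bvp f k0 k1 \<phi> M L0 L1 L2 L3
    by (rule fourth_order_bvp.intro) (fact assms)+
  \<comment> \<open>Solutions are continuous since they are differentiable, so the solutions within the bound are
    exactly the admissible fixed points.\<close>
  have solution_iff: "bvp_solution f k0 k1 \<phi> w \<and> (\<forall>x\<in>{0..1}. \<bar>w x\<bar> \<le> M0 * M)
      \<longleftrightarrow> admissible w \<and> (\<forall>x\<in>{0..1}. green_op w x = w x)" for w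
  proof -
    have "continuous_on {0..1} w" if "bvp_solution f k0 k1 \<phi> w"
    proof -
      have "nth_deriv_on {0..1} 0 w differentiable_on {0..1}"
        using that by (simp add: bvp_solution_def C_n_on_def)
      then show ?thesis
        by (simp add: nth_deriv_on_def differentiable_imp_continuous_on)
    qed
    then show ?thesis
      using bvp_solution_iff_fixed_point[of w] by (auto simp: admissible_def)
  qed
  obtain u where u: "admissible u" "\<forall>x\<in>{0..1}. green_op u x = u x"
    using fixed_point_exists by blast
  show ?thesis
    unfolding solution_iff
  proof (intro exI[of _ u] conjI allI impI ballI u)
    fix w and x :: real assume "admissible w \<and> (\<forall>x\<in>{0..1}. green_op w x = w x)" "x \<in> {0..1}"
    then show "w x = u x"
      using fixed_point_unique[OF u] by blast
  qed (use u in blast)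
qed

end
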